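(* Let $\mathbb{K}$ be an infinite field, let $r,s\geq 1$, and let $R=\mathbb{K}[x_1,\ldots,x_r;y_1,\ldots,y_s]$. Let $\mathcal{B}$ be a central arrangement of size $m_x\geq r$ in $\mathbb{K}^r$ with defining polynomial $f\in\mathbb{K}[x_1,\ldots,x_r]$, let $\mathcal{C}$ be a central arrangement of size $m_y\geq s$ in $\mathbb{K}^s$ with defining polynomial $g\in\mathbb{K}[y_1,\ldots,y_s]$, and let $F=fg\in R$ be the defining polynomial of the arrangement $\mathcal{A}=\mathcal{B}\cup\mathcal{C}$ in $\mathbb{K}^{r+s}$. Suppose that $J_f$ is a reduction of $\mathbb{I}_f$ of reduction number $\leq r-1$ and that $J_g$ is a reduction of $\mathbb{I}_g$ of reduction number $\leq s-1$. Then $J_F$ is a reduction of $\mathbb{I}_F$ of reduction number $\leq r+s-1$.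
   Context: A central arrangement of size $m$ in an affine space is given by nonzero, pairwise non-proportional linear forms $l_1,\ldots,l_m$ in the corresponding polynomial ring; its defining polynomial is $h=l_1\cdots l_m$. For such $h$, $J_h$ denotes the ideal generated by all partial derivatives of $h$ and $\mathbb{I}_h=\langle h/l_1,\ldots,h/l_m\rangle$ is the ideal generated by the $(m-1)$-fold products of the forms, both taken in the polynomial ring of the arrangement: $J_f,\mathbb{I}_f\subset\mathbb{K}[x_1,\ldots,x_r]$, $J_g,\mathbb{I}_g\subset\mathbb{K}[y_1,\ldots,y_s]$, $J_F,\mathbb{I}_F\subset R$. An ideal $J\subset I$ is a reduction of $I$ if $I^{k+1}=JI^{k}$ for some $k\geq 0$; the least such $k$ is the reduction number of $I$ with respect to $J$. *)

theory Defs
  imports HOL.Modules "HOL-Library.Cardinality" "HOL-Library.Poly_Mapping"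
begin

section \<open>Polynomials in finitely many variables\<close>

text \<open>Polynomials over \<open>'k\<close> whose variables are indexed by \<open>'v\<close>; a monomial is its exponent
  vector of type \<open>'v \<Rightarrow>\<^sub>0 nat\<close>.\<close>

type_synonym ('v, 'k) mpoly = "('v \<Rightarrow>\<^sub>0 nat) \<Rightarrow>\<^sub>0 'k"

definition const :: "'k::zero \<Rightarrow> ('v, 'k) mpoly" where
  "const c = Poly_Mapping.single 0 c"

definition var :: "'v \<Rightarrow> ('v, 'k::zero_neq_one) mpoly" where
  "var i = Poly_Mapping.single (Poly_Mapping.single i 1) 1"

text \<open>The truncated subtraction on exponents is harmless: if \<open>i\<close> does not occur in \<open>m\<close>,
  the coefficient of the corresponding summand is zero.\<close>

definition partial_deriv :: "'v \<Rightarrow> ('v, 'k::comm_ring_1) mpoly \<Rightarrow> ('v, 'k) mpoly" where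
  "partial_deriv i p = (\<Sum>m\<in>Poly_Mapping.keys p.
     Poly_Mapping.single (m - Poly_Mapping.single i 1)
       (of_nat (Poly_Mapping.lookup m i) * Poly_Mapping.lookup p m))"

text \<open>\<open>push \<phi>\<close> extends a map of indices additively. Applied to exponent vectors it renames the
  variables of a monomial; applied once more it renames the variables of a polynomial.\<close>

definition push :: "('a \<Rightarrow> 'b) \<Rightarrow> ('a \<Rightarrow>\<^sub>0 'c::comm_monoid_add) \<Rightarrow> ('b \<Rightarrow>\<^sub>0 'c)" where
  "push \<phi> p = (\<Sum>a\<in>Poly_Mapping.keys p. Poly_Mapping.single (\<phi> a) (Poly_Mapping.lookup p a))"

definition rename :: "('v \<Rightarrow> 'w) \<Rightarrow> ('v, 'k::comm_ring_1) mpoly \<Rightarrow> ('w, 'k) mpoly" where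
  "rename \<phi> = push (push \<phi>)"


section \<open>Ideals and reductions\<close>

text \<open>The submodules of a commutative ring, regarded as a module over itself, are its ideals.\<close>

definition ideal_gen :: "'a::comm_ring_1 set \<Rightarrow> 'a set" where
  "ideal_gen S = module.span times S"

definition ideal_mult :: "'a::comm_ring_1 set \<Rightarrow> 'a set \<Rightarrow> 'a set" where
  "ideal_mult I J = ideal_gen {a * b | a b. a \<in> I \<and> b \<in> J}"

primrec ideal_power :: "'a::comm_ring_1 set \<Rightarrow> nat \<Rightarrow> 'a set" where
  "ideal_power I 0 = UNIV"
| "ideal_power I (Suc k) = ideal_mult I (ideal_power I k)"

definition is_reduction :: "'a::comm_ring_1 set \<Rightarrow> 'a set \<Rightarrow> bool" where
  "is_reduction J I \<longleftrightarrow>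
     J \<subseteq> I \<and> (\<exists>k. ideal_power I (Suc k) = ideal_mult J (ideal_power I k))"

text \<open>Meaningful only if \<open>is_reduction J I\<close> holds.\<close>

definition reduction_number :: "'a::comm_ring_1 set \<Rightarrow> 'a set \<Rightarrow> nat" where
  "reduction_number J I =
     (LEAST k. ideal_power I (Suc k) = ideal_mult J (ideal_power I k))"


section \<open>Central arrangements\<close>

definition linear_form :: "('v::finite, 'k::comm_ring_1) mpoly \<Rightarrow> bool" where
  "linear_form p \<longleftrightarrow> (\<exists>a. p = (\<Sum>i\<in>UNIV. const (a i) * var i))"

definition proportional :: "('v, 'k::comm_ring_1) mpoly \<Rightarrow> ('v, 'k) mpoly \<Rightarrow> bool" where
  "proportional p q \<longleftrightarrow> (\<exists>c. p = const c * q)"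

text \<open>An arrangement is given by the set of its defining linear forms. Since these are pairwise
  non-proportional, they are pairwise distinct, and the size of the arrangement is the cardinality
  of the set.\<close>

definition central_arrangement :: "('v::finite, 'k::field) mpoly set \<Rightarrow> bool" where
  "central_arrangement L \<longleftrightarrow> finite L \<and> (\<forall>l\<in>L. linear_form l \<and> l \<noteq> 0) \<and>
     pairwise (\<lambda>p q. \<not> proportional p q) L"

definition defining_poly :: "('v, 'k::field) mpoly set \<Rightarrow> ('v, 'k) mpoly" where
  "defining_poly L = (\<Prod>l\<in>L. l)"

definition jacobian_ideal :: "('v, 'k::comm_ring_1) mpoly \<Rightarrow> ('v, 'k) mpoly set" where
  "jacobian_ideal h = ideal_gen (range (\<lambda>i. partial_deriv i h))"

text \<open>The product over \<open>L - {l}\<close> is the quotient \<open>h / l\<close> for \<open>h\<close> the defining polynomial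
  of \<open>L\<close>.\<close>

definition subproduct_ideal :: "('v, 'k::field) mpoly set \<Rightarrow> ('v, 'k) mpoly set" where
  "subproduct_ideal L = ideal_gen ((\<lambda>l. \<Prod>l'\<in>L - {l}. l') ` L)"

text \<open>The two arrangements live in polynomial rings with variables \<open>'r\<close> and \<open>'s\<close>; their union is
  taken in the polynomial ring with variables \<open>'r + 's\<close>.\<close>

definition union_arrangement ::
  "('r, 'k::field) mpoly set \<Rightarrow> ('s, 'k) mpoly set \<Rightarrow> ('r + 's, 'k) mpoly set" where
  "union_arrangement B C = rename Inl ` B \<union> rename Inr ` C"


section \<open>The union of two arrangements is an arrangement defined by the product\<close>

lemma push_superset:
  assumes "finite S" "Poly_Mapping.keys p \<subseteq> S"
  shows "push \<phi> p = (\<Sum>a\<in>S. Poly_Mapping.single (\<phi> a) (Poly_Mapping.lookup p a))"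
  unfolding push_def
  by (rule sum.mono_neutral_left) (use assms in \<open>auto simp: in_keys_iff\<close>)

lemma push_zero [simp]: "push \<phi> 0 = 0"
  by (simp add: push_def)

lemma push_single [simp]: "push \<phi> (Poly_Mapping.single a c) = Poly_Mapping.single (\<phi> a) c"
  by (cases "c = 0") (simp_all add: push_def)

lemma push_add: "push \<phi> (p + q) = push \<phi> p + push \<phi> q"
proof -
  let ?S = "Poly_Mapping.keys p \<union> Poly_Mapping.keys q"
  have "Poly_Mapping.keys (p + q) \<subseteq> ?S"
    by (rule Poly_Mapping.keys_add)
  then show ?thesis
    by (simp add: push_superset[of ?S] lookup_add single_add sum.distrib)
qed

lemma push_sum: "push \<phi> (\<Sum>x\<in>A. p x) = (\<Sum>x\<in>A. push \<phi> (p x))"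
  by (induction A rule: infinite_finite_induct) (simp_all add: push_add)

lemma sum_single_lookup:
  "p = (\<Sum>a\<in>Poly_Mapping.keys p. Poly_Mapping.single a (Poly_Mapping.lookup p a))"
  by (rule poly_mapping_eqI) (auto simp: lookup_sum lookup_single when_def in_keys_iff)

lemma lookup_push:
  assumes "inj \<phi>"
  shows "Poly_Mapping.lookup (push \<phi> p) (\<phi> a) = Poly_Mapping.lookup p a"
  using inj_eq[OF assms] by (auto simp: push_def lookup_sum lookup_single when_def in_keys_iff)

lemma inj_push:
  fixes \<phi> :: "'a \<Rightarrow> 'b"
  assumes "inj \<phi>"
  shows "inj (push \<phi> :: ('a \<Rightarrow>\<^sub>0 'c::comm_monoid_add) \<Rightarrow> _)"
proof (rule injI, rule poly_mapping_eqI)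
  fix p q :: "'a \<Rightarrow>\<^sub>0 'c" and a
  assume "push \<phi> p = push \<phi> q"
  then show "Poly_Mapping.lookup p a = Poly_Mapping.lookup q a"
    using lookup_push[OF assms, of p a] lookup_push[OF assms, of q a] by simp
qed

lemma inj_rename: "inj \<phi> \<Longrightarrow> inj (rename \<phi>)"
  unfolding rename_def by (intro inj_push)

lemma rename_zero [simp]: "rename \<phi> 0 = 0"
  by (simp add: rename_def)

lemma rename_one [simp]: "rename \<phi> 1 = 1"
  by (simp add: rename_def flip: single_one)

lemma rename_const [simp]: "rename \<phi> (const c) = const c"
  by (simp add: rename_def const_def)

lemma rename_var [simp]: "rename \<phi> (var i) = var (\<phi> i)"
  by (simp add: rename_def var_def)

lemma rename_add: "rename \<phi> (p + q) = rename \<phi> p + rename \<phi> q"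
  by (simp add: rename_def push_add)

lemma rename_sum: "rename \<phi> (\<Sum>x\<in>A. p x) = (\<Sum>x\<in>A. rename \<phi> (p x))"
  by (simp add: rename_def push_sum)

lemma rename_mult: "rename \<phi> (p * q) = rename \<phi> p * rename \<phi> q"
proof -
  let ?t = "\<lambda>p a. Poly_Mapping.single a (Poly_Mapping.lookup p a)"
  have "rename \<phi> ((\<Sum>a\<in>A. ?t p a) * (\<Sum>b\<in>B. ?t q b)) =
      rename \<phi> (\<Sum>a\<in>A. ?t p a) * rename \<phi> (\<Sum>b\<in>B. ?t q b)" for A B
    by (simp add: sum_product rename_def push_sum mult_single push_add)
  from this[of "Poly_Mapping.keys p" "Poly_Mapping.keys q"] show ?thesis
    by (simp only: sum_single_lookup[symmetric])
qed

lemma rename_prod: "rename \<phi> (\<Prod>x\<in>A. p x) = (\<Prod>x\<in>A. rename \<phi> (p x))"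
  by (induction A rule: infinite_finite_induct) (simp_all add: rename_mult)

lemma single_one_eq_iff:
  "Poly_Mapping.single i (Suc 0) = Poly_Mapping.single j (Suc 0) \<longleftrightarrow> i = j"
  by (metis lookup_single_eq lookup_single_not_eq old.nat.distinct(2))

lemma lookup_linear_form:
  fixes a :: "'v::finite \<Rightarrow> 'k::comm_ring_1"
  shows "Poly_Mapping.lookup (\<Sum>i\<in>UNIV. const (a i) * var i) (Poly_Mapping.single j 1) = a j"
proof -
  have "Poly_Mapping.lookup (\<Sum>i\<in>UNIV. const (a i) * var i) (Poly_Mapping.single j 1) =
      (\<Sum>i\<in>UNIV. if i = j then a i else 0)"
    unfolding lookup_sum
    by (rule sum.cong)
      (simp_all add: const_def var_def mult_single lookup_single when_def single_one_eq_iff)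
  then show ?thesis
    by simp
qed

lemma linear_form_eqI:
  assumes "linear_form p" "linear_form q"
    and "\<And>i. Poly_Mapping.lookup p (Poly_Mapping.single i 1) =
      Poly_Mapping.lookup q (Poly_Mapping.single i 1)"
  shows "p = q"
proof -
  obtain a b where "p = (\<Sum>i\<in>UNIV. const (a i) * var i)" "q = (\<Sum>i\<in>UNIV. const (b i) * var i)"
    using assms(1,2) unfolding linear_form_def by blast
  moreover from this have "a = b"
    using assms(3) by (intro ext) (simp add: lookup_linear_form del: One_nat_def)
  ultimately show ?thesis
    by simp
qed

lemma linear_form_rename:
  fixes \<phi> :: "'v::finite \<Rightarrow> 'w::finite"
  assumes "inj \<phi>" "linear_form p"
  shows "linear_form (rename \<phi> p)"
proof -
  obtain a where p: "p = (\<Sum>i\<in>UNIV. const (a i) * var i)"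
    using assms(2) unfolding linear_form_def by blast
  define b where "b = (\<lambda>w. if w \<in> range \<phi> then a (inv \<phi> w) else 0)"
  have "rename \<phi> p = (\<Sum>i\<in>UNIV. const (b (\<phi> i)) * var (\<phi> i))"
    by (simp add: p b_def rename_sum rename_mult assms(1))
  also have "\<dots> = (\<Sum>w\<in>range \<phi>. const (b w) * var w)"
    by (simp add: sum.reindex assms(1))
  also have "\<dots> = (\<Sum>w\<in>UNIV. const (b w) * var w)"
    by (rule sum.mono_neutral_left) (auto simp: b_def const_def)
  finally show ?thesis
    unfolding linear_form_def by blast
qed

lemma lookup_const_mult:
  "Poly_Mapping.lookup (const c * p) m = c * Poly_Mapping.lookup p m"
  by (simp add: const_def mult_map_scale_conv_mult[symmetric] Poly_Mapping.map.rep_eq when_def)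

lemma lookup_rename_other:
  assumes "linear_form p" "j \<notin> range \<phi>"
  shows "Poly_Mapping.lookup (rename \<phi> p) (Poly_Mapping.single j 1) = 0"
proof -
  obtain a where p: "p = (\<Sum>i\<in>UNIV. const (a i) * var i)"
    using assms(1) unfolding linear_form_def by blast
  have "rename \<phi> p = (\<Sum>i\<in>UNIV. const (a i) * var (\<phi> i))"
    by (simp add: p rename_sum rename_mult)
  then show ?thesis
    using assms(2) by (auto simp: lookup_sum lookup_const_mult var_def lookup_single when_def
        single_one_eq_iff intro!: sum.neutral)
qed

lemma lookup_rename:
  assumes "inj \<phi>"
  shows "Poly_Mapping.lookup (rename \<phi> p) (Poly_Mapping.single (\<phi> i) 1) =
    Poly_Mapping.lookup p (Poly_Mapping.single i 1)"
  using lookup_push[OF inj_push[OF assms], of p "Poly_Mapping.single i 1"]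
  by (simp add: rename_def)

lemma proportional_rename_iff:
  assumes "inj \<phi>"
  shows "proportional (rename \<phi> p) (rename \<phi> q) \<longleftrightarrow> proportional p q"
proof -
  have "rename \<phi> p = const c * rename \<phi> q \<longleftrightarrow> p = const c * q" for c
    using inj_eq[OF inj_rename[OF assms], of p "const c * q"] by (simp add: rename_mult)
  then show ?thesis
    by (simp add: proportional_def)
qed

lemma not_proportional_disjoint:
  fixes p :: "('v::finite, 'k::field) mpoly" and q :: "('w::finite, 'k) mpoly"
    and \<phi> :: "'v \<Rightarrow> 'u" and \<psi> :: "'w \<Rightarrow> 'u"
  assumes "inj \<phi>" "range \<phi> \<inter> range \<psi> = {}" "linear_form p" "p \<noteq> 0" "linear_form q"
  shows "\<not> proportional (rename \<phi> p) (rename \<psi> q)"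
proof
  assume "proportional (rename \<phi> p) (rename \<psi> q)"
  then obtain c where c: "rename \<phi> p = const c * rename \<psi> q"
    unfolding proportional_def by blast
  have "Poly_Mapping.lookup p (Poly_Mapping.single i 1) = 0" for i
  proof -
    have "\<phi> i \<notin> range \<psi>"
      using assms(2) by blast
    have "Poly_Mapping.lookup p (Poly_Mapping.single i 1) =
        Poly_Mapping.lookup (rename \<phi> p) (Poly_Mapping.single (\<phi> i) 1)"
      by (rule lookup_rename[OF assms(1), symmetric])
    also have "\<dots> = c * Poly_Mapping.lookup (rename \<psi> q) (Poly_Mapping.single (\<phi> i) 1)"
      unfolding c lookup_const_mult ..
    also have "\<dots> = 0"
      using lookup_rename_other[OF assms(5) \<open>\<phi> i \<notin> range \<psi>\<close>] by simp
    finally show ?thesis .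
  qed
  moreover have "linear_form (0 :: ('v, 'k) mpoly)"
    unfolding linear_form_def by (rule exI[of _ "\<lambda>_. 0"]) (simp add: const_def)
  ultimately have "p = 0"
    using assms(3) by (intro linear_form_eqI) auto
  with assms(4) show False ..
qed

lemma central_arrangement_union:
  fixes B :: "('r::finite, 'k::field) mpoly set" and C :: "('s::finite, 'k) mpoly set"
  assumes "central_arrangement B" "central_arrangement C"
  shows "central_arrangement (union_arrangement B C)"
proof -
  have nz: "rename \<phi> p \<noteq> 0" if "inj \<phi>" "p \<noteq> 0" for \<phi> :: "'x \<Rightarrow> 'y" and p :: "('x, 'k) mpoly"
    using inj_eq[OF inj_rename[OF that(1)], of p 0] that(2) by simp
  have "pairwise (\<lambda>p q. \<not> proportional p q) (union_arrangement B C)"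
    unfolding pairwise_def
  proof (intro ballI impI)
    fix p q
    assume pq: "p \<in> union_arrangement B C" "q \<in> union_arrangement B C" "p \<noteq> q"
    from assms have B: "b = b'" if "proportional b b'" "b \<in> B" "b' \<in> B" for b b'
      using that by (auto simp: central_arrangement_def pairwise_def)
    from assms have C: "c = c'" if "proportional c c'" "c \<in> C" "c' \<in> C" for c c'
      using that by (auto simp: central_arrangement_def pairwise_def)
    have BC: "\<not> proportional (rename Inl b :: ('r + 's, 'k) mpoly) (rename Inr c)"
      "\<not> proportional (rename Inr c :: ('r + 's, 'k) mpoly) (rename Inl b)"
      if "b \<in> B" "c \<in> C" for b c
    proof -
      have "linear_form b" "b \<noteq> 0" "linear_form c" "c \<noteq> 0"
        using that assms by (auto simp: central_arrangement_def)
      then show "\<not> proportional (rename Inl b :: ('r + 's, 'k) mpoly) (rename Inr c)"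
        "\<not> proportional (rename Inr c :: ('r + 's, 'k) mpoly) (rename Inl b)"
        by (intro not_proportional_disjoint; auto)+
    qed
    show "\<not> proportional p q"
      using pq BC by (auto simp: union_arrangement_def proportional_rename_iff dest: B C)
  qed
  then show ?thesis
    using assms unfolding central_arrangement_def
    by (auto simp: union_arrangement_def nz linear_form_rename)
qed

lemma
  fixes B :: "('r::finite, 'k::field) mpoly set" and C :: "('s::finite, 'k) mpoly set"
  assumes "central_arrangement B" "central_arrangement C"
  shows card_union_arrangement: "card (union_arrangement B C) = card B + card C" (is ?card)
    and defining_poly_union_arrangement: "defining_poly (union_arrangement B C) =
      rename Inl (defining_poly B) * rename Inr (defining_poly C)" (is ?poly)
proof -
  let ?l = "rename Inl :: ('r, 'k) mpoly \<Rightarrow> ('r + 's, 'k) mpoly"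
  let ?r = "rename Inr :: ('s, 'k) mpoly \<Rightarrow> ('r + 's, 'k) mpoly"
  have inj: "inj_on ?l B" "inj_on ?r C"
    by (rule inj_on_subset[OF inj_rename], simp_all)+
  have "?l ` B \<inter> ?r ` C = {}"
  proof (rule ccontr)
    assume "?l ` B \<inter> ?r ` C \<noteq> {}"
    then obtain b c where bc: "b \<in> B" "c \<in> C" "?l b = ?r c"
      by blast
    then have "proportional (?l b) (?r c)"
      unfolding proportional_def by (auto simp: const_def intro!: exI[of _ 1])
    moreover have "\<not> proportional (?l b) (?r c)"
      using bc assms by (intro not_proportional_disjoint) (auto simp: central_arrangement_def)
    ultimately show False
      by contradiction
  qed
  with inj show ?card ?poly
    using assms
    by (auto simp: central_arrangement_def defining_poly_def union_arrangement_def
        card_Un_disjoint card_image prod.union_disjoint prod.reindex rename_prod)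
qed

end

theory Submission
  imports Defs
begin

text \<open>
  Write \<open>I\<^sub>f R\<close> for the extension of an ideal to the large polynomial ring \<open>R\<close>. As \<open>f\<close> and \<open>g\<close> have
  no variable in common, the derivatives of \<open>F = f g\<close> are the products \<open>g \<cdot> \<partial>f\<close> and \<open>f \<cdot> \<partial>g\<close>, and
  the quotients of \<open>F\<close> by the linear forms are \<open>g \<cdot> (f / l)\<close> and \<open>f \<cdot> (g / l)\<close>. Therefore
  \<open>J\<^sub>F = g J\<^sub>f R + f J\<^sub>g R\<close> and \<open>I\<^sub>F = g I\<^sub>f R + f I\<^sub>g R\<close>
  (\<open>jacobian_ideal_rename_mult\<close>, \<open>subproduct_ideal_union_arrangement\<close>), and two general facts about
  reductions finish the proof.

  Extending an ideal along a ring homomorphism and multiplying it by an element \<open>u\<close> turns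
  \<open>I\<^bsup>k+1\<^esup> = J I\<^bsup>k\<^esup>\<close> into the same equation for the images, because the two sides carry the same
  power \<open>u\<^bsup>k+1\<^esup>\<close> (\<open>is_reduction_scaled_extension\<close>).

  Let \<open>P\<^sub>0\<close> and \<open>Q\<^sub>0\<close> be reductions of \<open>P\<close> and \<open>Q\<close> with reduction numbers \<open>a\<close> and \<open>b\<close>. The power
  \<open>(P + Q)\<^bsup>a+b+1\<^esup>\<close> is the sum of the products \<open>P\<^bsup>i\<^esup> Q\<^bsup>j\<^esup>\<close> with \<open>i + j = a + b + 1\<close>. In each of them
  \<open>i > a\<close> or \<open>j > b\<close>, so that a factor \<open>P\<close> may be replaced by \<open>P\<^sub>0\<close> or a factor \<open>Q\<close> by \<open>Q\<^sub>0\<close>. Hence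
  \<open>P\<^sub>0 + Q\<^sub>0\<close> is a reduction of \<open>P + Q\<close> of reduction number at most \<open>a + b\<close> (\<open>is_reduction_sum\<close>).
  Here \<open>a \<le> r - 1\<close> and \<open>b \<le> s - 1\<close>.
\<close>


section \<open>Generated ideals, products and powers\<close>

lemma module_times: "module (times :: 'a::comm_ring_1 \<Rightarrow> 'a \<Rightarrow> 'a)"
  by standard (simp_all add: algebra_simps)

lemma
  shows ideal_gen_base: "x \<in> S \<Longrightarrow> x \<in> ideal_gen S"
    and ideal_gen_zero: "0 \<in> ideal_gen S"
    and ideal_gen_add: "x \<in> ideal_gen S \<Longrightarrow> y \<in> ideal_gen S \<Longrightarrow> x + y \<in> ideal_gen S"
    and ideal_gen_times: "x \<in> ideal_gen S \<Longrightarrow> c * x \<in> ideal_gen S"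
  unfolding ideal_gen_def
  by (fact module.span_base[OF module_times] module.span_zero[OF module_times]
    module.span_add[OF module_times] module.span_scale[OF module_times])+

lemma ideal_gen_induct [consumes 1, case_names zero step]:
  assumes "x \<in> ideal_gen S" "P 0" "\<And>c s y. s \<in> S \<Longrightarrow> P y \<Longrightarrow> P (c * s + y)"
  shows "P x"
  using assms(1) unfolding ideal_gen_def
  by (rule module.span_induct_alt[OF module_times]) (fact assms)+

lemma ideal_gen_least:
  assumes "S \<subseteq> ideal_gen T"
  shows "ideal_gen S \<subseteq> ideal_gen T"
proof
  fix x assume "x \<in> ideal_gen S"
  then show "x \<in> ideal_gen T"
    using assms
    by (induction rule: ideal_gen_induct)
      (simp_all add: subset_iff ideal_gen_zero ideal_gen_add ideal_gen_times)
qed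

lemma ideal_gen_mono: "S \<subseteq> T \<Longrightarrow> ideal_gen S \<subseteq> ideal_gen T"
  by (intro ideal_gen_least) (auto intro: ideal_gen_base)

lemma ideal_gen_idem: "ideal_gen (ideal_gen S) = ideal_gen S"
  by (intro equalityI ideal_gen_least) (auto intro: ideal_gen_base)

lemma ideal_gen_Un: "ideal_gen (ideal_gen S \<union> ideal_gen T) = ideal_gen (S \<union> T)"
proof
  show "ideal_gen (ideal_gen S \<union> ideal_gen T) \<subseteq> ideal_gen (S \<union> T)"
    by (intro ideal_gen_least Un_least ideal_gen_mono) auto
  show "ideal_gen (S \<union> T) \<subseteq> ideal_gen (ideal_gen S \<union> ideal_gen T)"
    by (intro ideal_gen_mono) (auto intro: ideal_gen_base)
qed

lemma ideal_gen_eq_UNIV: "1 \<in> S \<Longrightarrow> ideal_gen S = UNIV"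
  using ideal_gen_times[OF ideal_gen_base, of 1 S] by auto

lemma ideal_mult_mono: "S \<subseteq> S' \<Longrightarrow> T \<subseteq> T' \<Longrightarrow> ideal_mult S T \<subseteq> ideal_mult S' T'"
  unfolding ideal_mult_def by (intro ideal_gen_mono) blast

lemma ideal_mult_memI: "s \<in> S \<Longrightarrow> t \<in> T \<Longrightarrow> s * t \<in> ideal_mult S T"
  unfolding ideal_mult_def by (intro ideal_gen_base) blast

lemma ideal_mult_least:
  assumes "\<And>s t. s \<in> S \<Longrightarrow> t \<in> T \<Longrightarrow> s * t \<in> ideal_gen U"
  shows "ideal_mult S T \<subseteq> ideal_gen U"
  unfolding ideal_mult_def by (intro ideal_gen_least) (use assms in blast)

lemma ideal_mult_commute: "ideal_mult S T = ideal_mult T S"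
proof -
  have "{s * t |s t. s \<in> S \<and> t \<in> T} = {t * s |t s. t \<in> T \<and> s \<in> S}"
    by (rule Collect_cong) (metis mult.commute)
  then show ?thesis
    by (simp add: ideal_mult_def)
qed

lemma ideal_mult_gen_left: "ideal_mult (ideal_gen S) T = ideal_mult S T"
proof
  have "x * t \<in> ideal_mult S T" if "x \<in> ideal_gen S" "t \<in> T" for x t
    using that(1)
  proof (induction rule: ideal_gen_induct)
    case zero
    then show ?case
      by (simp add: ideal_mult_def ideal_gen_zero)
  next
    case (step c s y)
    have "c * (s * t) + y * t \<in> ideal_mult S T"
      using ideal_mult_memI[OF step(1) that(2)] step(2) unfolding ideal_mult_def
      by (rule ideal_gen_add[OF ideal_gen_times])
    then show ?case
      by (simp add: algebra_simps)
  qed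
  then show "ideal_mult (ideal_gen S) T \<subseteq> ideal_mult S T"
    unfolding ideal_mult_def[of S] by (intro ideal_mult_least)
  show "ideal_mult S T \<subseteq> ideal_mult (ideal_gen S) T"
    by (intro ideal_mult_mono) (auto intro: ideal_gen_base)
qed

lemma ideal_mult_gen_right: "ideal_mult S (ideal_gen T) = ideal_mult S T"
  using ideal_mult_gen_left[of T S] by (simp add: ideal_mult_commute)

lemma ideal_mult_assoc: "ideal_mult (ideal_mult S T) U = ideal_mult S (ideal_mult T U)"
proof -
  have "{x * u |x u. x \<in> {s * t |s t. s \<in> S \<and> t \<in> T} \<and> u \<in> U} =
      {s * t * u |s t u. s \<in> S \<and> t \<in> T \<and> u \<in> U}"
    by blast
  also have "\<dots> = {s * y |s y. s \<in> S \<and> y \<in> {t * u |t u. t \<in> T \<and> u \<in> U}}"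
    unfolding mult.assoc by blast
  finally show ?thesis
    unfolding ideal_mult_def[of S T] ideal_mult_def[of T U] ideal_mult_gen_left
      ideal_mult_gen_right
    by (simp add: ideal_mult_def)
qed

lemma ideal_gen_ideal_mult: "ideal_gen (ideal_mult S T) = ideal_mult S T"
  by (simp add: ideal_mult_def ideal_gen_idem)

lemma ideal_gen_ideal_power: "ideal_gen (ideal_power I n) = ideal_power I n"
  by (cases n) (simp_all add: ideal_gen_ideal_mult ideal_gen_eq_UNIV)

lemma ideal_mult_UNIV_left: "ideal_mult UNIV S = ideal_gen S"
proof -
  have "ideal_mult UNIV S = ideal_mult {1} S"
    using ideal_mult_gen_left[of "{1}" S] by (simp add: ideal_gen_eq_UNIV)
  then show ?thesis
    by (simp add: ideal_mult_def)
qed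

lemma ideal_power_mono: "S \<subseteq> T \<Longrightarrow> ideal_power S n \<subseteq> ideal_power T n"
  by (induction n) (simp_all add: ideal_mult_mono)

lemma ideal_power_add: "ideal_mult (ideal_power I m) (ideal_power I n) = ideal_power I (m + n)"
  by (induction m) (simp_all add: ideal_mult_UNIV_left ideal_gen_ideal_power ideal_mult_assoc)


section \<open>Reductions of sums\<close>

lemma ideal_power_reduction_ge:
  assumes "ideal_power I (Suc a) = ideal_mult J (ideal_power I a)" "a \<le> n"
  shows "ideal_power I (Suc n) = ideal_mult J (ideal_power I n)"
  using assms(2)
proof (induction n rule: dec_induct)
  case base
  show ?case
    by (rule assms(1))
next
  case (step n)
  have "ideal_power I (Suc (Suc n)) = ideal_mult I (ideal_mult J (ideal_power I n))"
    using step.IH by simp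
  also have "\<dots> = ideal_mult (ideal_mult J I) (ideal_power I n)"
    by (simp only: ideal_mult_commute[of J I] ideal_mult_assoc)
  also have "\<dots> = ideal_mult J (ideal_power I (Suc n))"
    by (simp add: ideal_mult_assoc)
  finally show ?case .
qed

text \<open>One half of the binomial theorem \<open>(P + Q)\<^sup>n = \<Sum> P\<^sup>i Q\<^sup>j\<close> for ideals.\<close>

lemma ideal_power_sum_subset:
  "ideal_power (ideal_gen (P \<union> Q)) n \<subseteq>
     ideal_gen (\<Union>(i, j)\<in>{(i, j). i + j = n}. ideal_mult (ideal_power P i) (ideal_power Q j))"
    (is "_ \<subseteq> ideal_gen (?U n)")
proof (induction n)
  case 0
  have "(UNIV :: 'a set) = ideal_mult UNIV UNIV"
    by (simp add: ideal_mult_UNIV_left ideal_gen_eq_UNIV)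
  then show ?case
    by (simp add: ideal_gen_eq_UNIV)
next
  case (Suc n)
  have "ideal_power (ideal_gen (P \<union> Q)) (Suc n) \<subseteq>
      ideal_mult (ideal_gen (P \<union> Q)) (ideal_gen (?U n))"
    using Suc.IH by (simp add: ideal_mult_mono)
  also have "\<dots> = ideal_mult (P \<union> Q) (?U n)"
    by (simp only: ideal_mult_gen_left ideal_mult_gen_right)
  also have "\<dots> \<subseteq> ideal_gen (?U (Suc n))"
  proof (rule ideal_mult_least)
    fix x y assume x: "x \<in> P \<union> Q" and "y \<in> ?U n"
    then obtain i j where ij: "i + j = n" "y \<in> ideal_mult (ideal_power P i) (ideal_power Q j)"
      by blast
    have P: "x * y \<in> ideal_mult (ideal_power P (Suc i)) (ideal_power Q j)" if "x \<in> P"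
      using ideal_mult_memI[OF that ij(2)] by (simp add: ideal_mult_assoc)
    have "ideal_mult Q (ideal_mult (ideal_power P i) (ideal_power Q j)) =
        ideal_mult (ideal_power P i) (ideal_power Q (Suc j))"
      by (metis ideal_mult_assoc ideal_mult_commute ideal_power.simps(2))
    then have Q: "x * y \<in> ideal_mult (ideal_power P i) (ideal_power Q (Suc j))" if "x \<in> Q"
      using ideal_mult_memI[OF that ij(2)] by simp
    have "(Suc i, j) \<in> {(i, j). i + j = Suc n}" "(i, Suc j) \<in> {(i, j). i + j = Suc n}"
      using ij(1) by auto
    with x P Q have "x * y \<in> ?U (Suc n)"
      by blast
    then show "x * y \<in> ideal_gen (?U (Suc n))"
      by (rule ideal_gen_base)
  qed
  finally show ?case .
qed

lemma ideal_mult_powers_subset: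
  assumes "P \<subseteq> I" "Q \<subseteq> I"
  shows "ideal_mult (ideal_power P i) (ideal_power Q j) \<subseteq> ideal_power I (i + j)"
  unfolding ideal_power_add[symmetric] by (intro ideal_mult_mono ideal_power_mono assms)

lemma ideal_mult_powers_reduction:
  assumes "ideal_power P (Suc a) = ideal_mult P0 (ideal_power P a)"
    and "a < i" "i + j = Suc n" "P \<subseteq> I" "Q \<subseteq> I" "P0 \<subseteq> J"
  shows "ideal_mult (ideal_power P i) (ideal_power Q j) \<subseteq> ideal_mult J (ideal_power I n)"
proof -
  obtain k where k: "i = Suc k" "a \<le> k"
    using assms(2) by (cases i) auto
  have "ideal_mult (ideal_power P i) (ideal_power Q j) =
      ideal_mult P0 (ideal_mult (ideal_power P k) (ideal_power Q j))"
    by (simp only: k(1) ideal_power_reduction_ge[OF assms(1) k(2)] ideal_mult_assoc)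
  also have "\<dots> \<subseteq> ideal_mult J (ideal_power I (k + j))"
    by (intro ideal_mult_mono ideal_mult_powers_subset assms)
  also have "k + j = n"
    using assms(3) k(1) by simp
  finally show ?thesis .
qed

lemma ideal_power_reduction_number:
  assumes "is_reduction J I"
  defines "k \<equiv> reduction_number J I"
  shows "ideal_power I (Suc k) = ideal_mult J (ideal_power I k)"
  using assms(1) unfolding k_def is_reduction_def reduction_number_def
  by (intro LeastI_ex[where P = "\<lambda>k. ideal_power I (Suc k) = ideal_mult J (ideal_power I k)"])
    (rule conjunct2)

lemma is_reductionI:
  assumes "J \<subseteq> I" "ideal_power I (Suc k) = ideal_mult J (ideal_power I k)"
  shows "is_reduction J I \<and> reduction_number J I \<le> k"
  using assms unfolding is_reduction_def reduction_number_def by (blast intro: Least_le)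

text \<open>In a product \<open>P\<^sup>i Q\<^sup>j\<close> with \<open>i + j = a + b + 1\<close>, one exponent exceeds the reduction number \<open>a\<close>
  or \<open>b\<close> of its ideal, and one factor can be moved into the smaller ideal.\<close>

lemma is_reduction_sum:
  assumes P: "is_reduction P0 P" and Q: "is_reduction Q0 Q"
  shows "is_reduction (ideal_gen (P0 \<union> Q0)) (ideal_gen (P \<union> Q)) \<and>
    reduction_number (ideal_gen (P0 \<union> Q0)) (ideal_gen (P \<union> Q)) \<le>
      reduction_number P0 P + reduction_number Q0 Q"
proof (rule is_reductionI)
  define a b where "a = reduction_number P0 P" and "b = reduction_number Q0 Q"
  define I J where "I = ideal_gen (P \<union> Q)" and "J = ideal_gen (P0 \<union> Q0)"
  have sub: "P \<subseteq> I" "Q \<subseteq> I" "P0 \<subseteq> J" "Q0 \<subseteq> J"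
    by (auto simp: I_def J_def intro: ideal_gen_base)
  have "P0 \<subseteq> P" "Q0 \<subseteq> Q"
    using P Q by (simp_all add: is_reduction_def)
  then show "ideal_gen (P0 \<union> Q0) \<subseteq> ideal_gen (P \<union> Q)"
    by (intro ideal_gen_mono) auto
  then have "J \<subseteq> I"
    by (simp add: I_def J_def)
  have "ideal_power I (Suc (a + b)) = ideal_mult J (ideal_power I (a + b))"
  proof
    have "ideal_mult (ideal_power P i) (ideal_power Q j) \<subseteq> ideal_mult J (ideal_power I (a + b))"
      if "i + j = Suc (a + b)" for i j
    proof (cases "a < i")
      case True
      with that sub show ?thesis
        by (intro ideal_mult_powers_reduction[OF ideal_power_reduction_number[OF P]])
          (simp_all only: a_def)
    next
      case False
      with that have "b < j"
        by simp
      then have "ideal_mult (ideal_power Q j) (ideal_power P i) \<subseteq>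
          ideal_mult J (ideal_power I (a + b))"
        using that sub
        by (intro ideal_mult_powers_reduction[OF ideal_power_reduction_number[OF Q]])
          (simp_all only: b_def add.commute)
      then show ?thesis
        by (simp only: ideal_mult_commute)
    qed
    then have "(\<Union>(i, j)\<in>{(i, j). i + j = Suc (a + b)}.
        ideal_mult (ideal_power P i) (ideal_power Q j)) \<subseteq> ideal_mult J (ideal_power I (a + b))"
      by blast
    from ideal_gen_mono[OF this] ideal_power_sum_subset[of P Q "Suc (a + b)"]
    show "ideal_power I (Suc (a + b)) \<subseteq> ideal_mult J (ideal_power I (a + b))"
      unfolding ideal_gen_ideal_mult I_def by (rule order_trans[rotated])
    show "ideal_mult J (ideal_power I (a + b)) \<subseteq> ideal_power I (Suc (a + b))"
      using \<open>J \<subseteq> I\<close> by (simp add: ideal_mult_mono)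
  qed
  then show "ideal_power (ideal_gen (P \<union> Q))
      (Suc (reduction_number P0 P + reduction_number Q0 Q)) =
    ideal_mult (ideal_gen (P0 \<union> Q0))
      (ideal_power (ideal_gen (P \<union> Q)) (reduction_number P0 P + reduction_number Q0 Q))"
    by (simp only: a_def b_def I_def J_def)
qed


section \<open>Reductions under scaled extension\<close>

locale unital_ring_hom =
  fixes h :: "'a::comm_ring_1 \<Rightarrow> 'b::comm_ring_1"
  assumes hom_add: "h (x + y) = h x + h y"
    and hom_mult: "h (x * y) = h x * h y"
    and hom_one: "h 1 = 1"
begin

lemma hom_zero: "h 0 = 0"
  using hom_add[of 0 0] by simp

definition scaled_extension :: "'b \<Rightarrow> 'a set \<Rightarrow> 'b set" where
  "scaled_extension u I = ideal_gen ((\<lambda>x. u * h x) ` I)"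

lemma scaled_extension_mono: "I \<subseteq> J \<Longrightarrow> scaled_extension u I \<subseteq> scaled_extension u J"
  unfolding scaled_extension_def by (intro ideal_gen_mono) blast

lemma scaled_extension_ideal_gen: "scaled_extension u (ideal_gen S) = scaled_extension u S"
proof
  have "u * h x \<in> scaled_extension u S" if "x \<in> ideal_gen S" for x
    using that
  proof (induction rule: ideal_gen_induct)
    case zero
    then show ?case
      by (simp add: scaled_extension_def hom_zero ideal_gen_zero)
  next
    case (step c s y)
    then have "h c * (u * h s) + u * h y \<in> scaled_extension u S"
      unfolding scaled_extension_def
      by (intro ideal_gen_add[OF ideal_gen_times[OF ideal_gen_base]]) auto
    then show ?case
      by (simp add: hom_add hom_mult algebra_simps)
  qed
  then show "scaled_extension u (ideal_gen S) \<subseteq> scaled_extension u S"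
    unfolding scaled_extension_def by (intro ideal_gen_least) blast
  show "scaled_extension u S \<subseteq> scaled_extension u (ideal_gen S)"
    by (intro scaled_extension_mono) (auto intro: ideal_gen_base)
qed

lemma scaled_extension_mult:
  "scaled_extension (u * v) (ideal_mult I J) =
     ideal_mult (scaled_extension u I) (scaled_extension v J)"
proof -
  have "(\<lambda>x. u * v * h x) ` {x * y |x y. x \<in> I \<and> y \<in> J} =
      {x * y |x y. x \<in> (\<lambda>x. u * h x) ` I \<and> y \<in> (\<lambda>x. v * h x) ` J}" (is "?L = ?R")
  proof -
    have *: "u * v * h (x * y) = (u * h x) * (v * h y)" for x y
      by (simp add: hom_mult algebra_simps)
    have "?L = {u * v * h (x * y) |x y. x \<in> I \<and> y \<in> J}"
      by blast
    also have "\<dots> = ?R"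
      unfolding * by blast
    finally show ?thesis .
  qed
  then show ?thesis
    unfolding ideal_mult_def[of I] scaled_extension_ideal_gen
    by (simp add: scaled_extension_def ideal_mult_gen_left ideal_mult_gen_right)
      (simp add: ideal_mult_def)
qed

text \<open>The scaling factor becomes \<open>u\<^sup>n\<close>: this is what makes both sides of a reduction equation
  transform alike.\<close>

lemma scaled_extension_power:
  "scaled_extension (u ^ n) (ideal_power I n) = ideal_power (scaled_extension u I) n"
proof (induction n)
  case 0
  have "1 \<in> (\<lambda>x. 1 * h x) ` UNIV"
    using hom_one by (intro image_eqI[of _ _ 1]) simp_all
  then show ?case
    by (simp only: scaled_extension_def ideal_gen_eq_UNIV ideal_power.simps power_0)
next
  case (Suc n)
  then show ?case
    by (simp add: scaled_extension_mult)
qed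

lemma is_reduction_scaled_extension:
  assumes "is_reduction J I"
  shows "is_reduction (scaled_extension u J) (scaled_extension u I) \<and>
    reduction_number (scaled_extension u J) (scaled_extension u I) \<le> reduction_number J I"
proof (rule is_reductionI)
  let ?k = "reduction_number J I"
  show "scaled_extension u J \<subseteq> scaled_extension u I"
    using assms by (intro scaled_extension_mono) (simp add: is_reduction_def)
  have "ideal_power (scaled_extension u I) (Suc ?k) =
      scaled_extension (u * u ^ ?k) (ideal_mult J (ideal_power I ?k))"
    using scaled_extension_power[of u "Suc ?k" I] ideal_power_reduction_number[OF assms] by simp
  then show "ideal_power (scaled_extension u I) (Suc ?k) =
      ideal_mult (scaled_extension u J) (ideal_power (scaled_extension u I) ?k)"
    by (simp add: scaled_extension_mult scaled_extension_power)
qed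

end

interpretation rename_hom: unital_ring_hom "rename \<phi>" for \<phi>
  by unfold_locales (simp_all add: rename_add rename_mult)


section \<open>The two ideals of a union of arrangements\<close>

lemma partial_deriv_superset:
  assumes "finite S" "Poly_Mapping.keys p \<subseteq> S"
  shows "partial_deriv i p = (\<Sum>m\<in>S. Poly_Mapping.single (m - Poly_Mapping.single i 1)
    (of_nat (Poly_Mapping.lookup m i) * Poly_Mapping.lookup p m))"
  unfolding partial_deriv_def
  by (rule sum.mono_neutral_left) (use assms in \<open>auto simp: in_keys_iff\<close>)

lemma partial_deriv_add: "partial_deriv i (p + q) = partial_deriv i p + partial_deriv i q"
proof -
  let ?S = "Poly_Mapping.keys p \<union> Poly_Mapping.keys q"
  have "Poly_Mapping.keys (p + q) \<subseteq> ?S"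
    by (rule Poly_Mapping.keys_add)
  then show ?thesis
    by (simp add: partial_deriv_superset[of ?S] lookup_add single_add sum.distrib algebra_simps)
qed

lemma partial_deriv_zero: "partial_deriv i 0 = 0"
  by (simp add: partial_deriv_def)

lemma partial_deriv_sum: "partial_deriv i (\<Sum>x\<in>A. p x) = (\<Sum>x\<in>A. partial_deriv i (p x))"
  by (induction A rule: infinite_finite_induct) (simp_all add: partial_deriv_add partial_deriv_zero)

lemma partial_deriv_single:
  "partial_deriv i (Poly_Mapping.single m c) =
    Poly_Mapping.single (m - Poly_Mapping.single i 1) (of_nat (Poly_Mapping.lookup m i) * c)"
  by (cases "c = 0") (simp_all add: partial_deriv_def)

lemma lookup_push_other: "j \<notin> range \<phi> \<Longrightarrow> Poly_Mapping.lookup (push \<phi> p) j = 0"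
  by (auto simp: push_def lookup_sum lookup_single when_def intro!: sum.neutral)

lemma rename_single: "rename \<phi> (Poly_Mapping.single m c) = Poly_Mapping.single (push \<phi> m) c"
  by (simp add: rename_def)

text \<open>For factors without common variables, the product rule has a single term. Both sides are
  bilinear in \<open>p\<close> and \<open>q\<close>, so it suffices to compare them on monomials.\<close>

lemma partial_deriv_rename_mult:
  fixes p :: "('v, 'k::comm_ring_1) mpoly" and q :: "('w, 'k) mpoly"
  assumes "inj \<phi>" "\<phi> i \<notin> range \<psi>"
  shows "partial_deriv (\<phi> i) (rename \<psi> q * rename \<phi> p) = rename \<psi> q * rename \<phi> (partial_deriv i p)"
proof -
  have monom: "partial_deriv (\<phi> i)
      (rename \<psi> (Poly_Mapping.single b d) * rename \<phi> (Poly_Mapping.single a c)) =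
      rename \<psi> (Poly_Mapping.single b d) * rename \<phi> (partial_deriv i (Poly_Mapping.single a c))"
    for a c b and d :: 'k
  proof -
    have lookup: "Poly_Mapping.lookup (push \<psi> b + push \<phi> a) (\<phi> i) = Poly_Mapping.lookup a i"
      by (simp add: lookup_add lookup_push_other[OF assms(2)] lookup_push[OF assms(1)])
    show ?thesis
    proof (cases "Poly_Mapping.lookup a i = 0")
      case True
      with lookup show ?thesis
        by (simp add: rename_single mult_single partial_deriv_single)
    next
      case False
      define a' where "a' = a - Poly_Mapping.single i 1"
      have a: "a = a' + Poly_Mapping.single i 1"
        unfolding a'_def using False
        by (intro poly_mapping_eqI) (auto simp: lookup_add lookup_minus lookup_single when_def)
      have "push \<psi> b + push \<phi> a - Poly_Mapping.single (\<phi> i) 1 = push \<psi> b + push \<phi> a'"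
        by (simp add: a push_add flip: add.assoc)
      with lookup show ?thesis
        by (simp add: rename_single mult_single partial_deriv_single a'_def mult.left_commute)
    qed
  qed
  let ?t = "\<lambda>p a. Poly_Mapping.single a (Poly_Mapping.lookup p a)"
  have "partial_deriv (\<phi> i) (rename \<psi> (\<Sum>b\<in>B. ?t q b) * rename \<phi> (\<Sum>a\<in>A. ?t p a)) =
      rename \<psi> (\<Sum>b\<in>B. ?t q b) * rename \<phi> (partial_deriv i (\<Sum>a\<in>A. ?t p a))" for A B
    by (simp add: rename_sum partial_deriv_sum sum_product monom)
  from this[of "Poly_Mapping.keys q" "Poly_Mapping.keys p"] show ?thesis
    by (simp only: sum_single_lookup[symmetric])
qed

lemma jacobian_ideal_rename_mult:
  fixes f :: "('r, 'k::comm_ring_1) mpoly" and g :: "('s, 'k) mpoly"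
  shows "jacobian_ideal (rename Inl f * rename Inr g :: ('r + 's, 'k) mpoly) =
    ideal_gen (rename_hom.scaled_extension Inl (rename Inr g) (jacobian_ideal f) \<union>
      rename_hom.scaled_extension Inr (rename Inl f) (jacobian_ideal g))"
proof -
  let ?F = "rename Inl f * rename Inr g :: ('r + 's, 'k) mpoly"
  have l: "partial_deriv (Inl i) ?F = rename Inr g * rename Inl (partial_deriv i f)" for i
    using partial_deriv_rename_mult[of Inl i Inr g f] by (simp add: mult.commute image_iff)
  have r: "partial_deriv (Inr i) ?F = rename Inl f * rename Inr (partial_deriv i g)" for i
    using partial_deriv_rename_mult[of Inr i Inl f g] by (simp add: image_iff)
  have "range (\<lambda>i. partial_deriv i ?F) =
      (\<lambda>x. rename Inr g * rename Inl x) ` range (\<lambda>i. partial_deriv i f) \<union>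
      (\<lambda>x. rename Inl f * rename Inr x) ` range (\<lambda>i. partial_deriv i g)"
    unfolding UNIV_sum image_Un image_image l r ..
  then show ?thesis
    unfolding jacobian_ideal_def rename_hom.scaled_extension_ideal_gen
    by (simp add: rename_hom.scaled_extension_def ideal_gen_Un)
qed

text \<open>Hence removing a form of one arrangement from the union leaves the other arrangement whole, and
  the remaining product is a scaled generator.\<close>

lemma rename_images_disjoint:
  fixes B :: "('r::finite, 'k::field) mpoly set" and C :: "('s::finite, 'k) mpoly set"
  assumes "central_arrangement B" "central_arrangement C"
  shows "(rename Inl ` B :: ('r + 's, 'k) mpoly set) \<inter> rename Inr ` C = {}"
proof -
  have False if "b \<in> B" "c \<in> C" "(rename Inl b :: ('r + 's, 'k) mpoly) = rename Inr c" for b c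
  proof -
    have "proportional (rename Inl b :: ('r + 's, 'k) mpoly) (rename Inr c)"
      unfolding proportional_def by (rule exI[of _ 1]) (simp add: that(3) const_def)
    moreover have "\<not> proportional (rename Inl b :: ('r + 's, 'k) mpoly) (rename Inr c)"
      using that(1,2) assms
      by (intro not_proportional_disjoint) (auto simp: central_arrangement_def)
    ultimately show False
      by contradiction
  qed
  then show ?thesis
    by blast
qed

lemma subproduct_ideal_union_arrangement:
  fixes B :: "('r::finite, 'k::field) mpoly set" and C :: "('s::finite, 'k) mpoly set"
  assumes B: "central_arrangement B" and C: "central_arrangement C"
  shows "subproduct_ideal (union_arrangement B C) =
    ideal_gen (rename_hom.scaled_extension Inl (rename Inr (defining_poly C)) (subproduct_ideal B) \<union>
      rename_hom.scaled_extension Inr (rename Inl (defining_poly B)) (subproduct_ideal C))"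
proof -
  let ?l = "rename Inl :: ('r, 'k) mpoly \<Rightarrow> ('r + 's, 'k) mpoly"
  let ?r = "rename Inr :: ('s, 'k) mpoly \<Rightarrow> ('r + 's, 'k) mpoly"
  let ?A = "union_arrangement B C"
  have fin: "finite B" "finite C"
    using B C by (simp_all add: central_arrangement_def)
  have inj: "inj ?l" "inj ?r"
    by (simp_all add: inj_rename)
  note disj = rename_images_disjoint[OF B C]
  have prod_l: "prod (\<lambda>x. x) (?l ` X) = ?l (\<Prod>x\<in>X. x)" for X
    by (simp add: prod.reindex inj_on_subset[OF inj(1)] rename_prod)
  have prod_r: "prod (\<lambda>x. x) (?r ` X) = ?r (\<Prod>x\<in>X. x)" for X
    by (simp add: prod.reindex inj_on_subset[OF inj(2)] rename_prod)
  have l: "(\<Prod>l'\<in>?A - {?l b}. l') = ?r (defining_poly C) * ?l (\<Prod>l'\<in>B - {b}. l')"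
    if "b \<in> B" for b
  proof -
    have "?A - {?l b} = ?r ` C \<union> ?l ` (B - {b})"
      using disj that inj_eq[OF inj(1)] by (auto simp: union_arrangement_def)
    moreover have "?r ` C \<inter> ?l ` (B - {b}) = {}"
      using disj by blast
    ultimately show ?thesis
      using fin by (simp add: prod.union_disjoint prod_l prod_r defining_poly_def)
  qed
  have r: "(\<Prod>l'\<in>?A - {?r c}. l') = ?l (defining_poly B) * ?r (\<Prod>l'\<in>C - {c}. l')"
    if "c \<in> C" for c
  proof -
    have "?A - {?r c} = ?l ` B \<union> ?r ` (C - {c})"
      using disj that inj_eq[OF inj(2)] by (auto simp: union_arrangement_def)
    moreover have "?l ` B \<inter> ?r ` (C - {c}) = {}"
      using disj by blast
    ultimately show ?thesis
      using fin by (simp add: prod.union_disjoint prod_l prod_r defining_poly_def)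
  qed
  have "(\<lambda>l. \<Prod>l'\<in>?A - {l}. l') ` ?A =
      (\<lambda>b. \<Prod>l'\<in>?A - {?l b}. l') ` B \<union> (\<lambda>c. \<Prod>l'\<in>?A - {?r c}. l') ` C"
    by (simp only: union_arrangement_def image_Un image_image)
  also have "\<dots> =
      (\<lambda>x. ?r (defining_poly C) * ?l x) ` ((\<lambda>b. \<Prod>l'\<in>B - {b}. l') ` B) \<union>
      (\<lambda>x. ?l (defining_poly B) * ?r x) ` ((\<lambda>c. \<Prod>l'\<in>C - {c}. l') ` C)"
    unfolding image_image by (intro arg_cong2[where f = "(\<union>)"] image_cong refl l r)
  finally show ?thesis
    unfolding subproduct_ideal_def rename_hom.scaled_extension_ideal_gen
    by (simp add: rename_hom.scaled_extension_def ideal_gen_Un)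
qed


section \<open>The reduction for a union of arrangements\<close>

theorem proposition2p5:
  fixes B :: "('r::finite, 'k::field) mpoly set" and C :: "('s::finite, 'k) mpoly set"
    and f :: "('r, 'k) mpoly" and g :: "('s, 'k) mpoly"
    and A :: "('r + 's, 'k) mpoly set" and F :: "('r + 's, 'k) mpoly"
  assumes "infinite (UNIV :: 'k set)"
    and "central_arrangement B" and "card B \<ge> CARD('r)" and "f = defining_poly B"
    and "central_arrangement C" and "card C \<ge> CARD('s)" and "g = defining_poly C"
    and "A = union_arrangement B C" and "F = rename Inl f * rename Inr g"
    and "is_reduction (jacobian_ideal f) (subproduct_ideal B)"
    and "reduction_number (jacobian_ideal f) (subproduct_ideal B) \<le> CARD('r) - 1"
    and "is_reduction (jacobian_ideal g) (subproduct_ideal C)"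
    and "reduction_number (jacobian_ideal g) (subproduct_ideal C) \<le> CARD('s) - 1"
  shows "is_reduction (jacobian_ideal F) (subproduct_ideal A) \<and>
    reduction_number (jacobian_ideal F) (subproduct_ideal A) \<le> CARD('r) + CARD('s) - 1"
proof -
  let ?Jf = "rename_hom.scaled_extension Inl (rename Inr g :: ('r + 's, 'k) mpoly) (jacobian_ideal f)"
  let ?If = "rename_hom.scaled_extension Inl (rename Inr g :: ('r + 's, 'k) mpoly) (subproduct_ideal B)"
  let ?Jg = "rename_hom.scaled_extension Inr (rename Inl f :: ('r + 's, 'k) mpoly) (jacobian_ideal g)"
  let ?Ig = "rename_hom.scaled_extension Inr (rename Inl f :: ('r + 's, 'k) mpoly) (subproduct_ideal C)"
  have J: "jacobian_ideal F = ideal_gen (?Jf \<union> ?Jg)"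
    unfolding assms(9) by (rule jacobian_ideal_rename_mult)
  have I: "subproduct_ideal A = ideal_gen (?If \<union> ?Ig)"
    unfolding assms(4,7,8) by (rule subproduct_ideal_union_arrangement[OF assms(2,5)])
  have f: "is_reduction ?Jf ?If" "reduction_number ?Jf ?If \<le> CARD('r) - 1"
    using rename_hom.is_reduction_scaled_extension[OF assms(10)] assms(11) order_trans by blast+
  have g: "is_reduction ?Jg ?Ig" "reduction_number ?Jg ?Ig \<le> CARD('s) - 1"
    using rename_hom.is_reduction_scaled_extension[OF assms(12)] assms(13) order_trans by blast+
  show ?thesis
    using is_reduction_sum[OF f(1) g(1)] f(2) g(2) unfolding I J by linarith
qed

end
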